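(* Let $(A,\cdot,\alpha,\beta)$ be a BiHom-alternative algebra, $(V,L,R,\phi,\psi)$ a bimodule of it, and $T:V\to A$ an $\mathcal O$-operator associated to $(V,L,R,\phi,\psi)$. For $u,v\in V$ set $$u\prec v=R(T(v))u,\qquad u\succ v=L(T(u))v.$$ Then: (1) $(V,\prec,\succ,\phi,\psi)$ is a BiHom-pre-alternative algebra; consequently $(V,\circ=\prec+\succ,\phi,\psi)$ is its associated BiHom-alternative algebra, and $T:(V,\circ,\phi,\psi)\to(A,\cdot,\alpha,\beta)$ is a BiHom-alternative algebra morphism. (2) $T(V)=\{T(v):v\in V\}$ is a BiHom-alternative subalgebra of $(A,\cdot,\alpha,\beta)$, and $(T(V),\prec',\succ',\alpha,\beta)$ is a BiHom-pre-alternative algebra, where the operations are given by $T(u)\prec'T(v)=T(u\prec v)$ and $T(u)\succ'T(v)=T(u\succ v)$ for all $u,v\in V$. (3) The associated BiHom-alternative algebra $(T(V),\bullet=\prec'+\succ',\alpha,\beta)$ is just the BiHom-alternative subalgebra structure of $(A,\cdot,\alpha,\beta)$ on $T(V)$, and $T$ is a BiHom-alternative algebra morphism from $(V,\circ,\phi,\psi)$ to $(T(V),\bullet,\alpha,\beta)$.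
   Context: $\mathbb K$ is a field of characteristic $0$; all vector spaces are over $\mathbb K$; $gl(V)$ is the space of linear endomorphisms of $V$. A BiHom-alternative algebra is a quadruple $(A,\mu,\alpha,\beta)$ with $A$ a vector space, $\mu:A\times A\to A$ bilinear (written $xy=\mu(x,y)$), $\alpha,\beta:A\to A$ linear with $\alpha\beta=\beta\alpha$, $\alpha(xy)=\alpha(x)\alpha(y)$, $\beta(xy)=\beta(x)\beta(y)$, such that, with $as_{\alpha,\beta}(x,y,z)=\alpha(x)(yz)-(xy)\beta(z)$, for all $x,y,z\in A$: $as_{\alpha,\beta}(\beta(x),\alpha(y),z)+as_{\alpha,\beta}(\beta(y),\alpha(x),z)=0$ and $as_{\alpha,\beta}(x,\beta(y),\alpha(z))+as_{\alpha,\beta}(x,\beta(z),\alpha(y))=0$. A morphism of BiHom-alternative algebras is a linear map preserving products and intertwining the structure maps ($f\alpha=\alpha'f$, $f\beta=\beta'f$). A BiHom-alternative subalgebra is a subspace closed under the product and stable under $\alpha$ and $\beta$. A bimodule of a BiHom-alternative algebra $(A,\mu,\alpha,\beta)$ is a tuple $(V,L,R,\phi,\psi)$ with $V$ a vector space, $L,R:A\to gl(V)$ linear, $\phi,\psi\in gl(V)$ commuting, such that for all $x,y\in A$, $v\in V$: - $\phi L(x)=L(\alpha(x))\phi$, $\phi R(x)=R(\alpha(x))\phi$, $\psi L(x)=L(\beta(x))\psi$, $\psi R(x)=R(\beta(x))\psi$; - $L(\beta(x)\alpha(x))\psi(v)=L(\alpha\beta(x))L(\alpha(x))v$; - $R(\beta(x)\alpha(x))\phi(v)=R(\alpha\beta(x))R(\beta(x))v$;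 - $R(\beta(y))L(\beta(x))\phi(v)-L(\alpha\beta(x))R(y)\phi(v)=R(\alpha(x)y)\phi\psi(v)-R(\beta(y))R(\alpha(x))\psi(v)$; - $L(\alpha(y))R(\alpha(x))\psi(v)-R(\alpha\beta(x))L(y)\psi(v)=L(y\beta(x))\phi\psi(v)-L(\alpha(y))L(\beta(x))\phi(v)$. An $\mathcal O$-operator of $(A,\cdot,\alpha,\beta)$ associated to a bimodule $(V,L,R,\phi,\psi)$ is a linear map $T:V\to A$ with $T\phi=\alpha T$, $T\psi=\beta T$ and $T(u)\cdot T(v)=T\big(L(T(u))v+R(T(v))u\big)$ for all $u,v\in V$. A BiHom-pre-alternative algebra is a tuple $(A,\prec,\succ,\alpha,\beta)$ with $A$ a vector space, $\prec,\succ:A\times A\to A$ bilinear, $\alpha,\beta:A\to A$ commuting linear maps, each multiplicative for both $\prec$ and $\succ$, such that, writing $x\circ y=x\prec y+x\succ y$ and $as^r_{\alpha,\beta}(x,y,z)=(x\prec y)\prec\beta(z)-\alpha(x)\prec(y\circ z)$, $as^m_{\alpha,\beta}(x,y,z)=(x\succ y)\prec\beta(z)-\alpha(x)\succ(y\prec z)$, $as^l_{\alpha,\beta}(x,y,z)=(x\circ y)\succ\beta(z)-\alpha(x)\succ(y\succ z)$, for all $x,y,z\in A$: - $as^r_{\alpha,\beta}(x,\beta(y),\alpha(z))+as^r_{\alpha,\beta}(x,\beta(z),\alpha(y))=0$; - $as^l_{\alpha,\beta}(\beta(x),\alpha(y),z)+as^l_{\alpha,\beta}(\beta(y),\alpha(x),z)=0$;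 - $as^m_{\alpha,\beta}(\beta(x),\alpha(y),z)+as^r_{\alpha,\beta}(\beta(y),\alpha(x),z)=0$; - $as^m_{\alpha,\beta}(x,\beta(y),\alpha(z))+as^l_{\alpha,\beta}(x,\beta(z),\alpha(y))=0$. For such an algebra, $(A,\circ,\alpha,\beta)$ is a BiHom-alternative algebra, called the associated one. *)

theory Defs
  imports Complex_Main
begin

text \<open>
  A vector space over a field of characteristic zero is given by a scalar multiplication
  on a type together with a carrier that is a subspace; the carrier may be the whole type.
  The carrier is needed because the image of an \<open>\<O>\<close>-operator is itself to be
  regarded as an algebra.  Maps are relevant only on the carriers.
\<close>

definition linear_map_on ::
  "('k::field_char_0 \<Rightarrow> 'a::ab_group_add \<Rightarrow> 'a) \<Rightarrow> ('k \<Rightarrow> 'b::ab_group_add \<Rightarrow> 'b)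
    \<Rightarrow> 'a set \<Rightarrow> 'b set \<Rightarrow> ('a \<Rightarrow> 'b) \<Rightarrow> bool"
  where "linear_map_on s1 s2 U W f \<longleftrightarrow>
    (\<forall>x\<in>U. f x \<in> W) \<and>
    (\<forall>x\<in>U. \<forall>y\<in>U. f (x + y) = f x + f y) \<and>
    (\<forall>c. \<forall>x\<in>U. f (s1 c x) = s2 c (f x))"

definition bilinear_op_on ::
  "('k::field_char_0 \<Rightarrow> 'a::ab_group_add \<Rightarrow> 'a) \<Rightarrow> 'a set \<Rightarrow> ('a \<Rightarrow> 'a \<Rightarrow> 'a) \<Rightarrow> bool"
  where "bilinear_op_on s A m \<longleftrightarrow>
    (\<forall>x\<in>A. linear_map_on s s A A (\<lambda>y. m x y)) \<and>
    (\<forall>y\<in>A. linear_map_on s s A A (\<lambda>x. m x y))"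

text \<open>
  Linearity of \<open>L : A \<rightarrow> gl(V)\<close>: the first conjunct says that each \<open>L x\<close> lies in \<open>gl(V)\<close>,
  the second is linearity for the pointwise vector space structure of \<open>gl(V)\<close>.
\<close>
definition linear_to_gl ::
  "('k::field_char_0 \<Rightarrow> 'a::ab_group_add \<Rightarrow> 'a) \<Rightarrow> ('k \<Rightarrow> 'v::ab_group_add \<Rightarrow> 'v)
    \<Rightarrow> 'a set \<Rightarrow> 'v set \<Rightarrow> ('a \<Rightarrow> 'v \<Rightarrow> 'v) \<Rightarrow> bool"
  where "linear_to_gl sA sV A V L \<longleftrightarrow>
    (\<forall>x\<in>A. linear_map_on sV sV V V (L x)) \<and>
    (\<forall>v\<in>V. linear_map_on sA sV A V (\<lambda>x. L x v))"

definition multiplicative_on :: "'a set \<Rightarrow> ('a \<Rightarrow> 'a \<Rightarrow> 'a) \<Rightarrow> ('a \<Rightarrow> 'a) \<Rightarrow> bool"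
  where "multiplicative_on A m f \<longleftrightarrow> (\<forall>x\<in>A. \<forall>y\<in>A. f (m x y) = m (f x) (f y))"

locale bihom_space = vector_space scale
  for scale :: "'k::field_char_0 \<Rightarrow> 'a::ab_group_add \<Rightarrow> 'a" +
  fixes A :: "'a set" and \<alpha> \<beta> :: "'a \<Rightarrow> 'a"
  assumes subspace_carrier: "subspace A"
    and linear_\<alpha>: "linear_map_on scale scale A A \<alpha>"
    and linear_\<beta>: "linear_map_on scale scale A A \<beta>"
    and commute: "x \<in> A \<Longrightarrow> \<alpha> (\<beta> x) = \<beta> (\<alpha> x)"


subsection \<open>BiHom-alternative algebras\<close>

definition bihom_associator ::
  "('a::ab_group_add \<Rightarrow> 'a \<Rightarrow> 'a) \<Rightarrow> ('a \<Rightarrow> 'a) \<Rightarrow> ('a \<Rightarrow> 'a) \<Rightarrow> 'a \<Rightarrow> 'a \<Rightarrow> 'a \<Rightarrow> 'a"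
  where "bihom_associator m \<alpha> \<beta> x y z = m (\<alpha> x) (m y z) - m (m x y) (\<beta> z)"

locale bihom_alternative_algebra = bihom_space scale A \<alpha> \<beta>
  for scale :: "'k::field_char_0 \<Rightarrow> 'a::ab_group_add \<Rightarrow> 'a"
    and A :: "'a set" and m :: "'a \<Rightarrow> 'a \<Rightarrow> 'a" and \<alpha> \<beta> :: "'a \<Rightarrow> 'a" +
  assumes bilinear: "bilinear_op_on scale A m"
    and mult_\<alpha>: "multiplicative_on A m \<alpha>"
    and mult_\<beta>: "multiplicative_on A m \<beta>"
    and left_alternative: "\<lbrakk>x \<in> A; y \<in> A; z \<in> A\<rbrakk> \<Longrightarrow>
      bihom_associator m \<alpha> \<beta> (\<beta> x) (\<alpha> y) z + bihom_associator m \<alpha> \<beta> (\<beta> y) (\<alpha> x) z = 0"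
    and right_alternative: "\<lbrakk>x \<in> A; y \<in> A; z \<in> A\<rbrakk> \<Longrightarrow>
      bihom_associator m \<alpha> \<beta> x (\<beta> y) (\<alpha> z) + bihom_associator m \<alpha> \<beta> x (\<beta> z) (\<alpha> y) = 0"

locale bihom_alternative_morphism =
  dom: bihom_alternative_algebra s A m \<alpha> \<beta> +
  cod: bihom_alternative_algebra s' A' m' \<alpha>' \<beta>'
  for s :: "'k::field_char_0 \<Rightarrow> 'a::ab_group_add \<Rightarrow> 'a"
    and A :: "'a set" and m :: "'a \<Rightarrow> 'a \<Rightarrow> 'a" and \<alpha> \<beta> :: "'a \<Rightarrow> 'a"
    and s' :: "'k \<Rightarrow> 'b::ab_group_add \<Rightarrow> 'b"
    and A' :: "'b set" and m' :: "'b \<Rightarrow> 'b \<Rightarrow> 'b" and \<alpha>' \<beta>' :: "'b \<Rightarrow> 'b" +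
  fixes f :: "'a \<Rightarrow> 'b"
  assumes linear_f: "linear_map_on s s' A A' f"
    and f_mult: "\<lbrakk>x \<in> A; y \<in> A\<rbrakk> \<Longrightarrow> f (m x y) = m' (f x) (f y)"
    and f_\<alpha>: "x \<in> A \<Longrightarrow> f (\<alpha> x) = \<alpha>' (f x)"
    and f_\<beta>: "x \<in> A \<Longrightarrow> f (\<beta> x) = \<beta>' (f x)"

locale bihom_alternative_subalgebra = bihom_alternative_algebra scale A m \<alpha> \<beta>
  for scale :: "'k::field_char_0 \<Rightarrow> 'a::ab_group_add \<Rightarrow> 'a"
    and A :: "'a set" and m :: "'a \<Rightarrow> 'a \<Rightarrow> 'a" and \<alpha> \<beta> :: "'a \<Rightarrow> 'a" +
  fixes S :: "'a set"
  assumes sub_carrier: "S \<subseteq> A"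
    and sub_subspace: "subspace S"
    and sub_mult: "\<lbrakk>x \<in> S; y \<in> S\<rbrakk> \<Longrightarrow> m x y \<in> S"
    and sub_\<alpha>: "x \<in> S \<Longrightarrow> \<alpha> x \<in> S"
    and sub_\<beta>: "x \<in> S \<Longrightarrow> \<beta> x \<in> S"


subsection \<open>Bimodules and \<open>\<O>\<close>-operators\<close>

locale bihom_alternative_bimodule =
  alg: bihom_alternative_algebra sA A m \<alpha> \<beta> +
  md: bihom_space sV V \<phi> \<psi>
  for sA :: "'k::field_char_0 \<Rightarrow> 'a::ab_group_add \<Rightarrow> 'a"
    and A :: "'a set" and m :: "'a \<Rightarrow> 'a \<Rightarrow> 'a" and \<alpha> \<beta> :: "'a \<Rightarrow> 'a"
    and sV :: "'k \<Rightarrow> 'v::ab_group_add \<Rightarrow> 'v"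
    and V :: "'v set" and L R :: "'a \<Rightarrow> 'v \<Rightarrow> 'v" and \<phi> \<psi> :: "'v \<Rightarrow> 'v" +
  assumes linear_L: "linear_to_gl sA sV A V L"
    and linear_R: "linear_to_gl sA sV A V R"
    and \<phi>_L: "\<lbrakk>x \<in> A; v \<in> V\<rbrakk> \<Longrightarrow> \<phi> (L x v) = L (\<alpha> x) (\<phi> v)"
    and \<phi>_R: "\<lbrakk>x \<in> A; v \<in> V\<rbrakk> \<Longrightarrow> \<phi> (R x v) = R (\<alpha> x) (\<phi> v)"
    and \<psi>_L: "\<lbrakk>x \<in> A; v \<in> V\<rbrakk> \<Longrightarrow> \<psi> (L x v) = L (\<beta> x) (\<psi> v)"
    and \<psi>_R: "\<lbrakk>x \<in> A; v \<in> V\<rbrakk> \<Longrightarrow> \<psi> (R x v) = R (\<beta> x) (\<psi> v)"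
    and L_L: "\<lbrakk>x \<in> A; v \<in> V\<rbrakk> \<Longrightarrow>
      L (m (\<beta> x) (\<alpha> x)) (\<psi> v) = L (\<alpha> (\<beta> x)) (L (\<alpha> x) v)"
    and R_R: "\<lbrakk>x \<in> A; v \<in> V\<rbrakk> \<Longrightarrow>
      R (m (\<beta> x) (\<alpha> x)) (\<phi> v) = R (\<alpha> (\<beta> x)) (R (\<beta> x) v)"
    and R_L: "\<lbrakk>x \<in> A; y \<in> A; v \<in> V\<rbrakk> \<Longrightarrow>
      R (\<beta> y) (L (\<beta> x) (\<phi> v)) - L (\<alpha> (\<beta> x)) (R y (\<phi> v))
        = R (m (\<alpha> x) y) (\<phi> (\<psi> v)) - R (\<beta> y) (R (\<alpha> x) (\<psi> v))"
    and L_R: "\<lbrakk>x \<in> A; y \<in> A; v \<in> V\<rbrakk> \<Longrightarrow>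
      L (\<alpha> y) (R (\<alpha> x) (\<psi> v)) - R (\<alpha> (\<beta> x)) (L y (\<psi> v))
        = L (m y (\<beta> x)) (\<phi> (\<psi> v)) - L (\<alpha> y) (L (\<beta> x) (\<phi> v))"

locale bihom_O_operator = bihom_alternative_bimodule sA A m \<alpha> \<beta> sV V L R \<phi> \<psi>
  for sA :: "'k::field_char_0 \<Rightarrow> 'a::ab_group_add \<Rightarrow> 'a"
    and A :: "'a set" and m :: "'a \<Rightarrow> 'a \<Rightarrow> 'a" and \<alpha> \<beta> :: "'a \<Rightarrow> 'a"
    and sV :: "'k \<Rightarrow> 'v::ab_group_add \<Rightarrow> 'v"
    and V :: "'v set" and L R :: "'a \<Rightarrow> 'v \<Rightarrow> 'v" and \<phi> \<psi> :: "'v \<Rightarrow> 'v" +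
  fixes T :: "'v \<Rightarrow> 'a"
  assumes linear_T: "linear_map_on sV sA V A T"
    and T_\<phi>: "v \<in> V \<Longrightarrow> T (\<phi> v) = \<alpha> (T v)"
    and T_\<psi>: "v \<in> V \<Longrightarrow> T (\<psi> v) = \<beta> (T v)"
    and T_mult: "\<lbrakk>u \<in> V; v \<in> V\<rbrakk> \<Longrightarrow> m (T u) (T v) = T (L (T u) v + R (T v) u)"


subsection \<open>BiHom-pre-alternative algebras\<close>

definition sum_op :: "('a::ab_group_add \<Rightarrow> 'a \<Rightarrow> 'a) \<Rightarrow> ('a \<Rightarrow> 'a \<Rightarrow> 'a) \<Rightarrow> 'a \<Rightarrow> 'a \<Rightarrow> 'a"
  where "sum_op l r x y = l x y + r x y"

text \<open>
  In the three partial associators and in the locale below, \<open>l\<close> stands for \<open>\<prec>\<close> and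
  \<open>r\<close> for \<open>\<succ>\<close>.
\<close>

definition pre_associator_r ::
  "('a::ab_group_add \<Rightarrow> 'a \<Rightarrow> 'a) \<Rightarrow> ('a \<Rightarrow> 'a \<Rightarrow> 'a) \<Rightarrow> ('a \<Rightarrow> 'a) \<Rightarrow> ('a \<Rightarrow> 'a)
    \<Rightarrow> 'a \<Rightarrow> 'a \<Rightarrow> 'a \<Rightarrow> 'a"
  where "pre_associator_r l r \<alpha> \<beta> x y z = l (l x y) (\<beta> z) - l (\<alpha> x) (sum_op l r y z)"

definition pre_associator_m ::
  "('a::ab_group_add \<Rightarrow> 'a \<Rightarrow> 'a) \<Rightarrow> ('a \<Rightarrow> 'a \<Rightarrow> 'a) \<Rightarrow> ('a \<Rightarrow> 'a) \<Rightarrow> ('a \<Rightarrow> 'a)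
    \<Rightarrow> 'a \<Rightarrow> 'a \<Rightarrow> 'a \<Rightarrow> 'a"
  where "pre_associator_m l r \<alpha> \<beta> x y z = l (r x y) (\<beta> z) - r (\<alpha> x) (l y z)"

definition pre_associator_l ::
  "('a::ab_group_add \<Rightarrow> 'a \<Rightarrow> 'a) \<Rightarrow> ('a \<Rightarrow> 'a \<Rightarrow> 'a) \<Rightarrow> ('a \<Rightarrow> 'a) \<Rightarrow> ('a \<Rightarrow> 'a)
    \<Rightarrow> 'a \<Rightarrow> 'a \<Rightarrow> 'a \<Rightarrow> 'a"
  where "pre_associator_l l r \<alpha> \<beta> x y z = r (sum_op l r x y) (\<beta> z) - r (\<alpha> x) (r y z)"

locale bihom_pre_alternative_algebra = bihom_space scale A \<alpha> \<beta>
  for scale :: "'k::field_char_0 \<Rightarrow> 'a::ab_group_add \<Rightarrow> 'a"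
    and A :: "'a set" and l r :: "'a \<Rightarrow> 'a \<Rightarrow> 'a" and \<alpha> \<beta> :: "'a \<Rightarrow> 'a" +
  assumes bilinear_l: "bilinear_op_on scale A l"
    and bilinear_r: "bilinear_op_on scale A r"
    and mult_l_\<alpha>: "multiplicative_on A l \<alpha>"
    and mult_r_\<alpha>: "multiplicative_on A r \<alpha>"
    and mult_l_\<beta>: "multiplicative_on A l \<beta>"
    and mult_r_\<beta>: "multiplicative_on A r \<beta>"
    and pre_alternative_rr: "\<lbrakk>x \<in> A; y \<in> A; z \<in> A\<rbrakk> \<Longrightarrow>
      pre_associator_r l r \<alpha> \<beta> x (\<beta> y) (\<alpha> z) + pre_associator_r l r \<alpha> \<beta> x (\<beta> z) (\<alpha> y) = 0"
    and pre_alternative_ll: "\<lbrakk>x \<in> A; y \<in> A; z \<in> A\<rbrakk> \<Longrightarrow>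
      pre_associator_l l r \<alpha> \<beta> (\<beta> x) (\<alpha> y) z + pre_associator_l l r \<alpha> \<beta> (\<beta> y) (\<alpha> x) z = 0"
    and pre_alternative_mr: "\<lbrakk>x \<in> A; y \<in> A; z \<in> A\<rbrakk> \<Longrightarrow>
      pre_associator_m l r \<alpha> \<beta> (\<beta> x) (\<alpha> y) z + pre_associator_r l r \<alpha> \<beta> (\<beta> y) (\<alpha> x) z = 0"
    and pre_alternative_ml: "\<lbrakk>x \<in> A; y \<in> A; z \<in> A\<rbrakk> \<Longrightarrow>
      pre_associator_m l r \<alpha> \<beta> x (\<beta> y) (\<alpha> z) + pre_associator_l l r \<alpha> \<beta> x (\<beta> z) (\<alpha> y) = 0"

definition O_prec :: "('a \<Rightarrow> 'v \<Rightarrow> 'v) \<Rightarrow> ('v \<Rightarrow> 'a) \<Rightarrow> 'v \<Rightarrow> 'v \<Rightarrow> 'v"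
  where "O_prec R T u v = R (T v) u"

definition O_succ :: "('a \<Rightarrow> 'v \<Rightarrow> 'v) \<Rightarrow> ('v \<Rightarrow> 'a) \<Rightarrow> 'v \<Rightarrow> 'v \<Rightarrow> 'v"
  where "O_succ L T u v = L (T u) v"

text \<open>
  \<open>op'\<close> satisfies \<open>op' (T u) (T v) = T (op u v)\<close>.  This determines \<open>op'\<close> on \<open>T ` V\<close>, but
  whether such an \<open>op'\<close> exists (well-definedness) is a statement to be proved.
\<close>
definition induced_op ::
  "('v \<Rightarrow> 'a) \<Rightarrow> 'v set \<Rightarrow> ('v \<Rightarrow> 'v \<Rightarrow> 'v) \<Rightarrow> ('a \<Rightarrow> 'a \<Rightarrow> 'a) \<Rightarrow> bool"
  where "induced_op T V op op' \<longleftrightarrow> (\<forall>u\<in>V. \<forall>v\<in>V. op' (T u) (T v) = T (op u v))"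

end

theory Submission
  imports Defs
begin

text \<open>
  Write \<open>u \<prec> v = R (T v) u\<close>, \<open>u \<succ> v = L (T u) v\<close> and \<open>u \<odot> v = u \<prec> v + u \<succ> v\<close>.
  Everything rests on the identity \<open>T (u \<odot> v) = T u \<cdot> T v\<close>, which is the defining equation of an
  \<open>\<O>\<close>-operator.  It turns a product \<open>T u \<cdot> T v\<close> inside \<open>L\<close> or \<open>R\<close> into the argument
  of a nested \<open>\<prec>\<close> or \<open>\<succ>\<close>, so that each pre-alternative identity on \<open>V\<close> becomes a bimodule
  axiom at elements of \<open>T ` V\<close>: the mixed identities are the two compatibility axioms between \<open>L\<close>
  and \<open>R\<close>, and the symmetric ones are the polarised forms of the axioms for \<open>L\<close> and for \<open>R\<close>
  alone.  The sum \<open>\<odot>\<close> is alternative because its associator is, up to sign, the sum of the three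
  partial associators.

  The operations on \<open>T ` V\<close> exist because \<open>ker T\<close> is an ideal for both \<open>\<prec>\<close> and \<open>\<succ>\<close>: if
  \<open>T k = 0\<close>, then \<open>L (T k)\<close> and \<open>R (T k)\<close> vanish, so of the two summands of
  \<open>T (k \<odot> v) = 0\<close> and \<open>T (v \<odot> k) = 0\<close> only one is left, and it is zero.  Thus \<open>T ` V\<close> is a
  homomorphic image of a pre-alternative algebra, and all identities pass to it.
\<close>

section \<open>Linear and bilinear maps on carriers\<close>

lemma linear_map_onD:
  assumes "linear_map_on s1 s2 U W f"
  shows "x \<in> U \<Longrightarrow> f x \<in> W"
    and "x \<in> U \<Longrightarrow> y \<in> U \<Longrightarrow> f (x + y) = f x + f y"
    and "x \<in> U \<Longrightarrow> f (s1 c x) = s2 c (f x)"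
  using assms unfolding linear_map_on_def by auto

lemma linear_map_on_zero:
  assumes "linear_map_on s1 s2 U W f" and "0 \<in> U"
  shows "f 0 = 0"
  using linear_map_onD(2)[OF assms(1) assms(2) assms(2)] by simp

lemma linear_map_on_diff:
  assumes "linear_map_on s1 s2 U W f" and "x - y \<in> U" and "y \<in> U"
  shows "f (x - y) = f x - f y"
  using linear_map_onD(2)[OF assms] by simp

lemma linear_map_on_add:
  assumes "vector_space s2" and "module.subspace s2 W"
    and "linear_map_on s1 s2 U W f" and "linear_map_on s1 s2 U W g"
  shows "linear_map_on s1 s2 U W (\<lambda>x. f x + g x)"
proof -
  interpret vector_space s2 by fact
  show ?thesis
    using assms(3,4) subspace_add[OF assms(2)]
    unfolding linear_map_on_def by (auto simp: scale_right_distrib)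
qed

lemma bilinear_op_onD:
  assumes "bilinear_op_on s A m"
  shows "x \<in> A \<Longrightarrow> y \<in> A \<Longrightarrow> m x y \<in> A"
    and "x \<in> A \<Longrightarrow> y \<in> A \<Longrightarrow> z \<in> A \<Longrightarrow> m x (y + z) = m x y + m x z"
    and "x \<in> A \<Longrightarrow> y \<in> A \<Longrightarrow> z \<in> A \<Longrightarrow> m (x + y) z = m x z + m y z"
    and "x \<in> A \<Longrightarrow> y \<in> A \<Longrightarrow> m x (s c y) = s c (m x y)"
    and "x \<in> A \<Longrightarrow> y \<in> A \<Longrightarrow> m (s c x) y = s c (m x y)"
  using assms unfolding bilinear_op_on_def linear_map_on_def by auto

lemma subspace_linear_image:
  assumes "vector_space s1" and "vector_space s2" and "module.subspace s1 U"
    and f: "linear_map_on s1 s2 U W f"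
  shows "module.subspace s2 (f ` U)"
proof -
  interpret dom: vector_space s1 by fact
  interpret cod: vector_space s2 by fact
  note U = assms(3)
  show ?thesis
  proof (rule cod.subspaceI)
    show "0 \<in> f ` U"
      using linear_map_on_zero[OF f dom.subspace_0[OF U]] dom.subspace_0[OF U]
      by (metis image_eqI)
  next
    fix x y assume "x \<in> f ` U" "y \<in> f ` U"
    then show "x + y \<in> f ` U"
      using dom.subspace_add[OF U] by (auto simp: linear_map_onD(2)[OF f, symmetric])
  next
    fix c x assume "x \<in> f ` U"
    then show "s2 c x \<in> f ` U"
      using dom.subspace_scale[OF U] by (auto simp: linear_map_onD(3)[OF f, symmetric])
  qed
qed

text \<open>
  For an equation between values of \<open>op'\<close>, all arguments can be written as values of \<open>f\<close>; then the
  equation is the image under \<open>f\<close> of the one for \<open>op\<close>.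
\<close>
lemma bilinear_op_on_image:
  assumes "vector_space s1" and "module.subspace s1 U"
    and f: "linear_map_on s1 s2 U W f" and op: "bilinear_op_on s1 U op"
    and ind: "induced_op f U op op'"
  shows "bilinear_op_on s2 (f ` U) op'"
proof -
  interpret dom: vector_space s1 by fact
  note f_add = linear_map_onD(2)[OF f, symmetric] and f_scale = linear_map_onD(3)[OF f, symmetric]
  show ?thesis
    using ind unfolding bilinear_op_on_def linear_map_on_def induced_op_def
    by (auto simp: f_add f_scale bilinear_op_onD[OF op]
        dom.subspace_add[OF assms(2)] dom.subspace_scale[OF assms(2)])
qed

lemma multiplicative_on_image:
  assumes op: "bilinear_op_on s U op" and "multiplicative_on U op g"
    and g: "\<And>x. x \<in> U \<Longrightarrow> g x \<in> U" and fg: "\<And>x. x \<in> U \<Longrightarrow> f (g x) = g' (f x)"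
    and "induced_op f U op op'"
  shows "multiplicative_on (f ` U) op' g'"
  using assms(2,5) bilinear_op_onD(1)[OF op] g
  unfolding multiplicative_on_def induced_op_def by (auto simp: fg[symmetric])

lemma induced_op_sum_op:
  assumes f: "linear_map_on s1 s2 U W f"
    and "bilinear_op_on s1 U l" and "bilinear_op_on s1 U r"
    and "induced_op f U l l'" and "induced_op f U r r'"
  shows "induced_op f U (sum_op l r) (sum_op l' r')"
  using assms(4,5) linear_map_onD(2)[OF f] bilinear_op_onD(1)[OF assms(2)]
    bilinear_op_onD(1)[OF assms(3)]
  unfolding induced_op_def sum_op_def by simp

section \<open>Pre-alternative algebras: associated algebra and homomorphic images\<close>

context bihom_pre_alternative_algebra
begin

lemma \<alpha>_closed: "x \<in> A \<Longrightarrow> \<alpha> x \<in> A"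
  by (rule linear_map_onD(1)[OF linear_\<alpha>])

lemma \<beta>_closed: "x \<in> A \<Longrightarrow> \<beta> x \<in> A"
  by (rule linear_map_onD(1)[OF linear_\<beta>])

lemma bilinear_sum_op: "bilinear_op_on scale A (sum_op l r)"
  using bilinear_l bilinear_r
    linear_map_on_add[OF vector_space_axioms subspace_carrier]
  unfolding bilinear_op_on_def sum_op_def by blast

lemma sum_op_closed: "x \<in> A \<Longrightarrow> y \<in> A \<Longrightarrow> sum_op l r x y \<in> A"
  by (rule bilinear_op_onD(1)[OF bilinear_sum_op])

text \<open>
  Write \<open>x \<odot> y\<close> for \<open>x \<prec> y + x \<succ> y\<close>.  Then \<open>\<alpha> x \<odot> (y \<odot> z)\<close> splits into
  \<open>\<alpha> x \<prec> (y \<odot> z)\<close>, \<open>\<alpha> x \<succ> (y \<prec> z)\<close> and \<open>\<alpha> x \<succ> (y \<succ> z)\<close>, and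
  \<open>(x \<odot> y) \<odot> \<beta> z\<close> splits into \<open>(x \<prec> y) \<prec> \<beta> z\<close>, \<open>(x \<succ> y) \<prec> \<beta> z\<close> and
  \<open>(x \<odot> y) \<succ> \<beta> z\<close>; the three pairs belong to the partial associators \<open>r\<close>, \<open>m\<close>, \<open>l\<close>.
  The sign appears because the associator and the partial associators subtract in opposite order.
\<close>
lemma associator_sum_op:
  assumes "x \<in> A" "y \<in> A" "z \<in> A"
  shows "bihom_associator (sum_op l r) \<alpha> \<beta> x y z =
    - (pre_associator_r l r \<alpha> \<beta> x y z + pre_associator_m l r \<alpha> \<beta> x y z
        + pre_associator_l l r \<alpha> \<beta> x y z)"
  using assms
  unfolding bihom_associator_def pre_associator_r_def pre_associator_m_def
    pre_associator_l_def sum_op_def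
  by (simp add: bilinear_op_onD[OF bilinear_l] bilinear_op_onD[OF bilinear_r]
      \<alpha>_closed \<beta>_closed)

theorem associated_bihom_alternative_algebra:
  "bihom_alternative_algebra scale A (sum_op l r) \<alpha> \<beta>"
proof
  show "bilinear_op_on scale A (sum_op l r)" by (rule bilinear_sum_op)
  show "multiplicative_on A (sum_op l r) \<alpha>"
    using mult_l_\<alpha> mult_r_\<alpha> linear_map_onD(2)[OF linear_\<alpha>]
      bilinear_op_onD(1)[OF bilinear_l] bilinear_op_onD(1)[OF bilinear_r]
    unfolding multiplicative_on_def sum_op_def by simp
  show "multiplicative_on A (sum_op l r) \<beta>"
    using mult_l_\<beta> mult_r_\<beta> linear_map_onD(2)[OF linear_\<beta>]
      bilinear_op_onD(1)[OF bilinear_l] bilinear_op_onD(1)[OF bilinear_r]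
    unfolding multiplicative_on_def sum_op_def by simp
next
  fix x y z assume xyz: "x \<in> A" "y \<in> A" "z \<in> A"
  \<comment> \<open>The mixed identity is not symmetric in \<open>x\<close> and \<open>y\<close>; both instances together account for all
    \<open>m\<close>- and \<open>r\<close>-terms.\<close>
  from pre_alternative_ll[OF xyz] pre_alternative_mr[OF xyz]
    pre_alternative_mr[OF xyz(2,1,3)]
  show "bihom_associator (sum_op l r) \<alpha> \<beta> (\<beta> x) (\<alpha> y) z
      + bihom_associator (sum_op l r) \<alpha> \<beta> (\<beta> y) (\<alpha> x) z = 0"
    by (simp add: associator_sum_op xyz \<alpha>_closed \<beta>_closed algebra_simps
        add_eq_0_iff2)
next
  fix x y z assume xyz: "x \<in> A" "y \<in> A" "z \<in> A"
  from pre_alternative_rr[OF xyz] pre_alternative_ml[OF xyz]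
    pre_alternative_ml[OF xyz(1,3,2)]
  show "bihom_associator (sum_op l r) \<alpha> \<beta> x (\<beta> y) (\<alpha> z)
      + bihom_associator (sum_op l r) \<alpha> \<beta> x (\<beta> z) (\<alpha> y) = 0"
    by (simp add: associator_sum_op xyz \<alpha>_closed \<beta>_closed algebra_simps
        add_eq_0_iff2)
qed

text \<open>
  The codomain carries no algebra structure beforehand.  The partial associators are made of the
  operations, the structure maps and differences, with all of which \<open>f\<close> commutes; so each identity
  on the image is \<open>f 0 = 0\<close>.
\<close>
theorem image_bihom_pre_alternative_algebra:
  fixes s' :: "'k \<Rightarrow> 'b::ab_group_add \<Rightarrow> 'b"
  assumes "vector_space s'" and f: "linear_map_on scale s' A B f"
    and f\<alpha>: "\<And>x. x \<in> A \<Longrightarrow> f (\<alpha> x) = \<alpha>' (f x)"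
    and f\<beta>: "\<And>x. x \<in> A \<Longrightarrow> f (\<beta> x) = \<beta>' (f x)"
    and l': "induced_op f A l l'" and r': "induced_op f A r r'"
  shows "bihom_pre_alternative_algebra s' (f ` A) l' r' \<alpha>' \<beta>'"
proof -
  interpret cod: vector_space s' by fact
  note f_add = linear_map_onD(2)[OF f]
    and closed = bilinear_op_onD(1)[OF bilinear_l] bilinear_op_onD(1)[OF bilinear_r]
      sum_op_closed \<alpha>_closed \<beta>_closed
  have f_diff: "f (x - y) = f x - f y" if "x \<in> A" "y \<in> A" for x y
    using linear_map_on_diff[OF f subspace_diff[OF subspace_carrier that] that(2)] .
  have f_l: "l' (f x) (f y) = f (l x y)" if "x \<in> A" "y \<in> A" for x y
    using l' that unfolding induced_op_def by blast
  have f_r: "r' (f x) (f y) = f (r x y)" if "x \<in> A" "y \<in> A" for x y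
    using r' that unfolding induced_op_def by blast
  have f_sum: "sum_op l' r' (f x) (f y) = f (sum_op l r x y)" if "x \<in> A" "y \<in> A" for x y
    using induced_op_sum_op[OF f bilinear_l bilinear_r l' r'] that
    unfolding induced_op_def by blast
  have linear_image: "linear_map_on s' s' (f ` A) (f ` A) g'"
    if g: "linear_map_on scale scale A A g" and fg: "\<And>x. x \<in> A \<Longrightarrow> f (g x) = g' (f x)" for g g'
    unfolding linear_map_on_def
    by (auto simp: fg[symmetric] linear_map_onD[OF g] f_add[symmetric]
        linear_map_onD(3)[OF f, symmetric] subspace_add[OF subspace_carrier]
        subspace_scale[OF subspace_carrier])
  have assoc_closed: "pre_associator_r l r \<alpha> \<beta> x y z \<in> A" "pre_associator_m l r \<alpha> \<beta> x y z \<in> A"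
    "pre_associator_l l r \<alpha> \<beta> x y z \<in> A" if "x \<in> A" "y \<in> A" "z \<in> A" for x y z
    unfolding pre_associator_r_def pre_associator_m_def pre_associator_l_def
    using that by (simp_all add: subspace_diff[OF subspace_carrier] closed)
  have assoc_r: "pre_associator_r l' r' \<alpha>' \<beta>' (f x) (f y) (f z) = f (pre_associator_r l r \<alpha> \<beta> x y z)"
    and assoc_m: "pre_associator_m l' r' \<alpha>' \<beta>' (f x) (f y) (f z) = f (pre_associator_m l r \<alpha> \<beta> x y z)"
    and assoc_l: "pre_associator_l l' r' \<alpha>' \<beta>' (f x) (f y) (f z) = f (pre_associator_l l r \<alpha> \<beta> x y z)"
    if "x \<in> A" "y \<in> A" "z \<in> A" for x y z
    unfolding pre_associator_r_def pre_associator_m_def pre_associator_l_def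
    using that by (simp_all add: f\<alpha>[symmetric] f\<beta>[symmetric] f_l f_r f_sum f_diff closed)
  note transfer = f\<alpha>[symmetric] f\<beta>[symmetric] assoc_r assoc_m assoc_l assoc_closed
    \<alpha>_closed \<beta>_closed f_add[symmetric]
    linear_map_on_zero[OF f subspace_0[OF subspace_carrier]]
  show ?thesis
  proof
    show "cod.subspace (f ` A)"
      by (rule subspace_linear_image[OF vector_space_axioms assms(1) subspace_carrier f])
    show "linear_map_on s' s' (f ` A) (f ` A) \<alpha>'" "linear_map_on s' s' (f ` A) (f ` A) \<beta>'"
      by (rule linear_image[OF linear_\<alpha> f\<alpha>] linear_image[OF linear_\<beta> f\<beta>]; assumption)+
    show "\<alpha>' (\<beta>' x) = \<beta>' (\<alpha>' x)" if "x \<in> f ` A" for x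
      using that commute by (auto simp: transfer)
    show "bilinear_op_on s' (f ` A) l'" "bilinear_op_on s' (f ` A) r'"
      by (rule bilinear_op_on_image[OF vector_space_axioms subspace_carrier f bilinear_l l']
          bilinear_op_on_image[OF vector_space_axioms subspace_carrier f bilinear_r r'])+
    show "multiplicative_on (f ` A) l' \<alpha>'" "multiplicative_on (f ` A) l' \<beta>'"
      using multiplicative_on_image[OF bilinear_l mult_l_\<alpha> \<alpha>_closed f\<alpha> l']
        multiplicative_on_image[OF bilinear_l mult_l_\<beta> \<beta>_closed f\<beta> l'] by auto
    show "multiplicative_on (f ` A) r' \<alpha>'" "multiplicative_on (f ` A) r' \<beta>'"
      using multiplicative_on_image[OF bilinear_r mult_r_\<alpha> \<alpha>_closed f\<alpha> r']
        multiplicative_on_image[OF bilinear_r mult_r_\<beta> \<beta>_closed f\<beta> r'] by auto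
  qed (auto simp: transfer pre_alternative_rr pre_alternative_ll pre_alternative_mr
      pre_alternative_ml)
qed

end

section \<open>The pre-alternative algebra of an O-operator\<close>

context bihom_alternative_bimodule
begin

lemma L_closed: "x \<in> A \<Longrightarrow> v \<in> V \<Longrightarrow> L x v \<in> V"
  and L_add_left: "x \<in> A \<Longrightarrow> y \<in> A \<Longrightarrow> v \<in> V \<Longrightarrow> L (x + y) v = L x v + L y v"
  and L_add_right: "x \<in> A \<Longrightarrow> v \<in> V \<Longrightarrow> w \<in> V \<Longrightarrow> L x (v + w) = L x v + L x w"
  using linear_L unfolding linear_to_gl_def linear_map_on_def by auto

lemma R_closed: "x \<in> A \<Longrightarrow> v \<in> V \<Longrightarrow> R x v \<in> V"
  and R_add_left: "x \<in> A \<Longrightarrow> y \<in> A \<Longrightarrow> v \<in> V \<Longrightarrow> R (x + y) v = R x v + R y v"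
  and R_add_right: "x \<in> A \<Longrightarrow> v \<in> V \<Longrightarrow> w \<in> V \<Longrightarrow> R x (v + w) = R x v + R x w"
  using linear_R unfolding linear_to_gl_def linear_map_on_def by auto

lemma L_zero_left: "v \<in> V \<Longrightarrow> L 0 v = 0"
  using linear_L linear_map_on_zero[OF _ alg.subspace_0[OF alg.subspace_carrier]]
  unfolding linear_to_gl_def by blast

lemma R_zero_left: "v \<in> V \<Longrightarrow> R 0 v = 0"
  using linear_R linear_map_on_zero[OF _ alg.subspace_0[OF alg.subspace_carrier]]
  unfolding linear_to_gl_def by blast

lemmas carrier_closed =
  linear_map_onD(1)[OF alg.linear_\<alpha>] linear_map_onD(1)[OF alg.linear_\<beta>]
  linear_map_onD(1)[OF md.linear_\<alpha>] linear_map_onD(1)[OF md.linear_\<beta>]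
  bilinear_op_onD(1)[OF alg.bilinear] alg.subspace_add[OF alg.subspace_carrier]
  L_closed R_closed

text \<open>
  Polarisation: both sides of the axiom for a single \<open>x\<close> are quadratic in \<open>x\<close>; expanding it at
  \<open>x + y\<close> and cancelling the instances at \<open>x\<close> and at \<open>y\<close> leaves the cross terms.
\<close>
lemma L_L_polarised:
  assumes x: "x \<in> A" and y: "y \<in> A" and v: "v \<in> V"
  shows "L (m (\<beta> x) (\<alpha> y)) (\<psi> v) + L (m (\<beta> y) (\<alpha> x)) (\<psi> v)
    = L (\<alpha> (\<beta> x)) (L (\<alpha> y) v) + L (\<alpha> (\<beta> y)) (L (\<alpha> x) v)"
  using L_L[OF alg.subspace_add[OF alg.subspace_carrier x y] v] L_L[OF x v] L_L[OF y v]
  by (simp add: assms carrier_closed linear_map_onD(2)[OF alg.linear_\<alpha>]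
      linear_map_onD(2)[OF alg.linear_\<beta>] bilinear_op_onD(2,3)[OF alg.bilinear]
      L_add_left L_add_right algebra_simps)

lemma R_R_polarised:
  assumes x: "x \<in> A" and y: "y \<in> A" and v: "v \<in> V"
  shows "R (m (\<beta> x) (\<alpha> y)) (\<phi> v) + R (m (\<beta> y) (\<alpha> x)) (\<phi> v)
    = R (\<alpha> (\<beta> x)) (R (\<beta> y) v) + R (\<alpha> (\<beta> y)) (R (\<beta> x) v)"
  using R_R[OF alg.subspace_add[OF alg.subspace_carrier x y] v] R_R[OF x v] R_R[OF y v]
  by (simp add: assms carrier_closed linear_map_onD(2)[OF alg.linear_\<alpha>]
      linear_map_onD(2)[OF alg.linear_\<beta>] bilinear_op_onD(2,3)[OF alg.bilinear]
      R_add_left R_add_right algebra_simps)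

end

context bihom_O_operator
begin

abbreviation prec (infixl "\<prec>" 70) where "prec \<equiv> O_prec R T"
abbreviation succ (infixl "\<succ>" 70) where "succ \<equiv> O_succ L T"
abbreviation circ (infixl "\<odot>" 70) where "circ \<equiv> sum_op prec succ"

lemma T_closed: "v \<in> V \<Longrightarrow> T v \<in> A"
  by (rule linear_map_onD(1)[OF linear_T])

lemma T_diff: "u \<in> V \<Longrightarrow> v \<in> V \<Longrightarrow> T (u - v) = T u - T v"
  by (rule linear_map_on_diff[OF linear_T md.subspace_diff[OF md.subspace_carrier]])

lemma T_circ: "u \<in> V \<Longrightarrow> v \<in> V \<Longrightarrow> T (u \<odot> v) = m (T u) (T v)"
  by (simp add: T_mult sum_op_def O_prec_def O_succ_def add.commute)

lemma bilinear_prec: "bilinear_op_on sV V prec"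
  and bilinear_succ: "bilinear_op_on sV V succ"
  using linear_L linear_R T_closed
  unfolding bilinear_op_on_def linear_to_gl_def linear_map_on_def O_prec_def O_succ_def
  by (auto simp: linear_map_onD[OF linear_T])

lemma prec_succ_bihom_pre_alternative_algebra:
  "bihom_pre_alternative_algebra sV V prec succ \<phi> \<psi>"
proof
  show "bilinear_op_on sV V prec" "bilinear_op_on sV V succ"
    by (rule bilinear_prec bilinear_succ)+
  show "multiplicative_on V prec \<phi>" "multiplicative_on V succ \<phi>"
    "multiplicative_on V prec \<psi>" "multiplicative_on V succ \<psi>"
    unfolding multiplicative_on_def O_prec_def O_succ_def
    by (simp_all add: T_\<phi> T_\<psi> T_closed \<phi>_L \<phi>_R \<psi>_L \<psi>_R)
next
  note unfold_assoc = pre_associator_r_def pre_associator_m_def pre_associator_l_def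
    O_prec_def O_succ_def T_circ T_\<phi> T_\<psi> T_closed
    carrier_closed alg.commute[symmetric] md.commute[symmetric]
  fix x y z assume xyz: "x \<in> V" "y \<in> V" "z \<in> V"
  note Txyz = xyz[THEN T_closed]
  show "pre_associator_r prec succ \<phi> \<psi> x (\<psi> y) (\<phi> z)
      + pre_associator_r prec succ \<phi> \<psi> x (\<psi> z) (\<phi> y) = 0"
    using R_R_polarised[OF Txyz(2,3) xyz(1)] xyz
    by (simp add: unfold_assoc algebra_simps)
  show "pre_associator_l prec succ \<phi> \<psi> (\<psi> x) (\<phi> y) z
      + pre_associator_l prec succ \<phi> \<psi> (\<psi> y) (\<phi> x) z = 0"
    using L_L_polarised[OF Txyz(1,2) xyz(3)] xyz
    by (simp add: unfold_assoc algebra_simps)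
  show "pre_associator_m prec succ \<phi> \<psi> (\<psi> x) (\<phi> y) z
      + pre_associator_r prec succ \<phi> \<psi> (\<psi> y) (\<phi> x) z = 0"
    using R_L[OF Txyz(1,3) xyz(2)] xyz
    by (simp add: unfold_assoc algebra_simps)
  show "pre_associator_m prec succ \<phi> \<psi> x (\<psi> y) (\<phi> z)
      + pre_associator_l prec succ \<phi> \<psi> x (\<psi> z) (\<phi> y) = 0"
    using L_R[OF Txyz(3,1) xyz(2)] xyz
    by (simp add: unfold_assoc algebra_simps)
qed

sublocale pre: bihom_pre_alternative_algebra sV V prec succ \<phi> \<psi>
  by (rule prec_succ_bihom_pre_alternative_algebra)

lemma T_morphism: "bihom_alternative_morphism sV V circ \<phi> \<psi> sA A m \<alpha> \<beta> T"
  by (intro bihom_alternative_morphism.intro pre.associated_bihom_alternative_algebra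
      alg.bihom_alternative_algebra_axioms bihom_alternative_morphism_axioms.intro
      linear_T T_circ T_\<phi> T_\<psi>)

lemma image_subalgebra: "bihom_alternative_subalgebra sA A m \<alpha> \<beta> (T ` V)"
proof
  show "T ` V \<subseteq> A" using T_closed by blast
  show "alg.subspace (T ` V)"
    by (rule subspace_linear_image[OF md.vector_space_axioms alg.vector_space_axioms
          md.subspace_carrier linear_T])
next
  fix x y assume "x \<in> T ` V" "y \<in> T ` V"
  then show "m x y \<in> T ` V"
    by (auto simp: T_circ[symmetric] pre.sum_op_closed)
next
  fix x assume "x \<in> T ` V"
  then show "\<alpha> x \<in> T ` V" "\<beta> x \<in> T ` V"
    by (auto simp: T_\<phi>[symmetric] T_\<psi>[symmetric] carrier_closed)
qed

section \<open>The induced operations on the image\<close>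

lemma kernel_prec:
  assumes "k \<in> V" "v \<in> V" "T k = 0"
  shows "T (k \<prec> v) = 0"
  \<comment> \<open>The product \<open>m 0 (T v)\<close> vanishes by bilinearity, and the summand \<open>L 0 v\<close> drops out.\<close>
  using T_mult[OF assms(1,2)] bilinear_op_onD(3)[OF alg.bilinear, of 0 0 "T v"]
    T_closed[OF assms(2)] alg.subspace_0[OF alg.subspace_carrier]
  by (simp add: assms L_zero_left O_prec_def)

lemma kernel_succ:
  assumes "k \<in> V" "v \<in> V" "T k = 0"
  shows "T (v \<succ> k) = 0"
  using T_mult[OF assms(2,1)] bilinear_op_onD(2)[OF alg.bilinear, of "T v" 0 0]
    T_closed[OF assms(2)] alg.subspace_0[OF alg.subspace_carrier]
  by (simp add: assms R_zero_left O_succ_def)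

text \<open>
  The second argument of \<open>\<prec>\<close> and the first of \<open>\<succ>\<close> enter only through \<open>T\<close>, so it suffices
  to vary the other one within its fibre, that is, by an element of the kernel.
\<close>
lemma T_prec_cong:
  assumes "u \<in> V" "u' \<in> V" "v \<in> V" "T u = T u'" "T v = T v'"
  shows "T (u \<prec> v) = T (u' \<prec> v')"
proof -
  have k: "u - u' \<in> V" by (rule md.subspace_diff[OF md.subspace_carrier assms(1,2)])
  have "T ((u - u') \<prec> v) = 0"
    by (rule kernel_prec[OF k assms(3)]) (simp add: T_diff assms)
  moreover have "u \<prec> v = (u - u') \<prec> v + u' \<prec> v"
    using bilinear_op_onD(3)[OF bilinear_prec k assms(2,3)] by simp
  ultimately have "T (u \<prec> v) = T (u' \<prec> v)"
    using linear_map_onD(2)[OF linear_T] bilinear_op_onD(1)[OF bilinear_prec] k assms by simp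
  then show ?thesis by (simp add: O_prec_def assms)
qed

lemma T_succ_cong:
  assumes "u \<in> V" "v \<in> V" "v' \<in> V" "T u = T u'" "T v = T v'"
  shows "T (u \<succ> v) = T (u' \<succ> v')"
proof -
  have k: "v - v' \<in> V" by (rule md.subspace_diff[OF md.subspace_carrier assms(2,3)])
  have "T (u \<succ> (v - v')) = 0"
    by (rule kernel_succ[OF k assms(1)]) (simp add: T_diff assms)
  moreover have "u \<succ> v = u \<succ> (v - v') + u \<succ> v'"
    using bilinear_op_onD(2)[OF bilinear_succ assms(1) k assms(3)] by simp
  ultimately have "T (u \<succ> v) = T (u \<succ> v')"
    using linear_map_onD(2)[OF linear_T] bilinear_op_onD(1)[OF bilinear_succ] k assms by simp
  then show ?thesis by (simp add: O_succ_def assms)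
qed

lemma ex_induced_op: "\<exists>l' r'. induced_op T V prec l' \<and> induced_op T V succ r'"
proof (intro exI conjI)
  let ?g = "inv_into V T"
  have g: "?g (T v) \<in> V" "T (?g (T v)) = T v" if "v \<in> V" for v
    using that by (simp_all add: inv_into_into f_inv_into_f)
  show "induced_op T V prec (\<lambda>x y. T (?g x \<prec> ?g y))"
    unfolding induced_op_def using g by (intro ballI T_prec_cong) auto
  show "induced_op T V succ (\<lambda>x y. T (?g x \<succ> ?g y))"
    unfolding induced_op_def using g by (intro ballI T_succ_cong) auto
qed

context
  fixes l' r'
  assumes l': "induced_op T V prec l'" and r': "induced_op T V succ r'"
begin

lemma induced_bihom_pre_alternative_algebra:
  "bihom_pre_alternative_algebra sA (T ` V) l' r' \<alpha> \<beta>"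
  by (rule pre.image_bihom_pre_alternative_algebra[OF alg.vector_space_axioms linear_T
        T_\<phi> T_\<psi> l' r'])

lemma induced_sum_op: "x \<in> T ` V \<Longrightarrow> y \<in> T ` V \<Longrightarrow> sum_op l' r' x y = m x y"
  using induced_op_sum_op[OF linear_T bilinear_prec bilinear_succ l' r']
  unfolding induced_op_def by (auto simp: T_circ)

lemma T_morphism_image:
  "bihom_alternative_morphism sV V circ \<phi> \<psi> sA (T ` V) (sum_op l' r') \<alpha> \<beta> T"
proof -
  have "linear_map_on sV sA V (T ` V) T"
    using linear_T unfolding linear_map_on_def by blast
  then show ?thesis
    by (intro bihom_alternative_morphism.intro pre.associated_bihom_alternative_algebra
        bihom_pre_alternative_algebra.associated_bihom_alternative_algebra
        induced_bihom_pre_alternative_algebra bihom_alternative_morphism_axioms.intro)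
      (simp_all add: induced_sum_op T_circ T_\<phi> T_\<psi>)
qed

end

end

theorem proposition1p8:
  fixes sA :: "'k::field_char_0 \<Rightarrow> 'a::ab_group_add \<Rightarrow> 'a"
    and A :: "'a set" and m :: "'a \<Rightarrow> 'a \<Rightarrow> 'a" and \<alpha> \<beta> :: "'a \<Rightarrow> 'a"
    and sV :: "'k \<Rightarrow> 'v::ab_group_add \<Rightarrow> 'v"
    and V :: "'v set" and L R :: "'a \<Rightarrow> 'v \<Rightarrow> 'v" and \<phi> \<psi> :: "'v \<Rightarrow> 'v"
    and T :: "'v \<Rightarrow> 'a"
    and l r :: "'v \<Rightarrow> 'v \<Rightarrow> 'v"
  assumes "bihom_alternative_algebra sA A m \<alpha> \<beta>"
    and "bihom_alternative_bimodule sA A m \<alpha> \<beta> sV V L R \<phi> \<psi>"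
    and "bihom_O_operator sA A m \<alpha> \<beta> sV V L R \<phi> \<psi> T"
  defines "l \<equiv> O_prec R T" and "r \<equiv> O_succ L T"
  shows
    "(bihom_pre_alternative_algebra sV V l r \<phi> \<psi> \<and>
      bihom_alternative_algebra sV V (sum_op l r) \<phi> \<psi> \<and>
      bihom_alternative_morphism sV V (sum_op l r) \<phi> \<psi> sA A m \<alpha> \<beta> T) \<and>
     bihom_alternative_subalgebra sA A m \<alpha> \<beta> (T ` V) \<and>
     (\<exists>l' r'. induced_op T V l l' \<and> induced_op T V r r') \<and>
     (\<forall>l' r'. induced_op T V l l' \<and> induced_op T V r r' \<longrightarrow>
        bihom_pre_alternative_algebra sA (T ` V) l' r' \<alpha> \<beta> \<and>
        bihom_alternative_algebra sA (T ` V) (sum_op l' r') \<alpha> \<beta> \<and>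
        (\<forall>x\<in>T ` V. \<forall>y\<in>T ` V. sum_op l' r' x y = m x y) \<and>
        bihom_alternative_morphism sV V (sum_op l r) \<phi> \<psi> sA (T ` V) (sum_op l' r') \<alpha> \<beta> T)"
proof -
  interpret bihom_O_operator sA A m \<alpha> \<beta> sV V L R \<phi> \<psi> T by fact
  show ?thesis
    unfolding l_def r_def
    using pre.bihom_pre_alternative_algebra_axioms pre.associated_bihom_alternative_algebra
      T_morphism image_subalgebra ex_induced_op induced_bihom_pre_alternative_algebra
      bihom_pre_alternative_algebra.associated_bihom_alternative_algebra[OF
        induced_bihom_pre_alternative_algebra]
      induced_sum_op T_morphism_image
    by (intro conjI allI impI ballI) auto
qed

end
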